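(* Let $T\in(0,\infty)$, $\lambda>0$, $\alpha,\nu\in(0,1]$ and $\rho\in[0,1]$, and let $N_\rho^{\alpha,\nu}(\cdot)=\{N_\rho^{\alpha,\nu}(t):t\in[0,T]\}$ be the correlated counting process $N_\rho(\cdot)$ (see context) for which the probability generating function of $M_g$ is $g(u)=E_{\nu,1}(-\lambda^\alpha T^\nu(1-u)^\alpha)$ and the common distribution function of the random variables $X_n^{F,\rho}$ is $F(t)=(t/T)^{\nu/\alpha}$ for $t\in[0,T]$. Then for every $t\in[0,T]$ and every integer $k\ge 0$, $$P(N_\rho^{\alpha,\nu}(t)=k)=(1-\rho)\frac{(-1)^k}{k!}\sum_{r=0}^\infty\frac{(-\lambda^\alpha t^\nu)^r}{\Gamma(\nu r+1)}\frac{\Gamma(\alpha r+1)}{\Gamma(\alpha r+1-k)}+\rho\left\{\left(1-(t/T)^{\nu/\alpha}\right)1_{k=0}+(t/T)^{\nu/\alpha}\cdot\frac{(-1)^k}{k!}\sum_{r=0}^\infty\frac{(-\lambda^\alpha T^\nu)^r}{\Gamma(\nu r+1)}\frac{\Gamma(\alpha r+1)}{\Gamma(\alpha r+1-k)}\right\}.$$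
   Context: Conventions: $1/\Gamma(x)=0$ when $x\in\{0,-1,-2,\ldots\}$; $0^0=1$; $1_{k=0}$ is $1$ if $k=0$ and $0$ otherwise. Mittag-Leffler function: $E_{\alpha,\beta}(x)=\sum_{r\ge 0}\frac{x^r}{\Gamma(\alpha r+\beta)}$. Correlated counting process: for $\rho\in[0,1]$ and $T\in(0,\infty)$, $N_\rho(t)=\sum_{n=1}^{M_g}1_{[0,t]}(X_n^{F,\rho})$, $t\in[0,T]$, where $M_g$ is a nonnegative integer valued random variable with probability generating function $g(u)=\mathbb{E}[u^{M_g}]$, and $\{X_n^{F,\rho}:n\ge1\}$ is a sequence of random variables, independent of $M_g$, with common distribution function $F$ such that $F(0)=0$, $F(T)=1$, and with common pairwise correlation coefficient $\rho$. The dependence structure is the one for which, for each $t\in[0,T]$, the law of $N_\rho(t)$ is given by the following formulas (recalled from the literature and used as standing facts about these processes): the probability generating function is $$G_{N_\rho(t)}(u)=\rho(1-F(t))+\rho F(t)g(u)+(1-\rho)g(1-F(t)+F(t)u),$$ equivalently, for all $k\ge0$, $$P(N_\rho(t)=k)=(1-\rho)P(N_0(t)=k)+\rho\{(1-F(t))1_{k=0}+F(t)P(M_g=k)\},$$ $$P(N_0(t)=k)=\sum_{n=k}^\infty\binom{n}{k}F^k(t)(1-F(t))^{n-k}P(M_g=n).$$ It is known (and may be taken for granted) that the function $g$ in the claim is the probability generating function of a nonnegative integer valued random variable. *)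

theory Defs
  imports "HOL-Probability.Probability"
begin

text \<open>The reciprocal Gamma function \<^const>\<open>rGamma\<close> vanishes at the nonpositive integers,
  which is the convention \<open>1 / \<Gamma>(x) = 0\<close> at the poles of \<open>\<Gamma>\<close>.\<close>

definition mittag_leffler :: "real \<Rightarrow> real \<Rightarrow> real \<Rightarrow> real" where
  "mittag_leffler \<alpha> \<beta> x = (\<Sum>r. x ^ r * rGamma (\<alpha> * real r + \<beta>))"

definition (in prob_space) pgf :: "('a \<Rightarrow> nat) \<Rightarrow> real \<Rightarrow> real" where
  "pgf Y u = expectation (\<lambda>\<omega>. u ^ Y \<omega>)"

text \<open>If one of the variances is zero the correlation is undefined mathematically; here it is then
  \<open>0\<close>, by \<open>x / 0 = 0\<close>.\<close>

definition (in prob_space) correlation :: "('a \<Rightarrow> real) \<Rightarrow> ('a \<Rightarrow> real) \<Rightarrow> real" where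
  "correlation Y Z =
     expectation (\<lambda>\<omega>. (Y \<omega> - expectation Y) * (Z \<omega> - expectation Z)) /
     sqrt (variance Y * variance Z)"

definition counting_process ::
    "('a \<Rightarrow> nat) \<Rightarrow> (nat \<Rightarrow> 'a \<Rightarrow> real) \<Rightarrow> real \<Rightarrow> 'a \<Rightarrow> nat" where
  "counting_process Mg X t \<omega> = (\<Sum>n = 1..Mg \<omega>. indicator {0..t} (X n \<omega>))"

text \<open>The variables are \<open>X n\<close> for \<open>n \<ge> 1\<close>; \<open>X 0\<close> is unconstrained and never used.
  Only the values of \<open>F\<close> on \<open>{0..T}\<close> matter: as \<open>F 0 = 0\<close> and \<open>F T = 1\<close>, they determine
  the distribution function on the whole real line.

  \<open>Mg_indep_X\<close> says that the \<open>\<sigma>\<close>-algebras generated by \<open>Mg\<close> and by the whole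
  sequence are independent (\<open>indep_var\<close> would need both to have the same type).

  The assumption \<open>pgf_counting_process\<close> specifies the dependence structure of the \<open>X n\<close>
  through the one-dimensional laws it produces; pairwise correlation \<open>\<rho>\<close> alone does not
  determine these laws. A realisation: with probability \<open>\<rho>\<close> all \<open>X n\<close> equal one common
  variable with distribution function \<open>F\<close>, and otherwise they are i.i.d. with distribution
  function \<open>F\<close>. The formula for the point probabilities of \<open>counting_process Mg X t\<close> is
  equivalent to this assumption and is not assumed separately.\<close>

locale correlated_counting_process = prob_space M
  for M :: "'a measure"
    and T \<rho> :: real
    and Mg :: "'a \<Rightarrow> nat"
    and X :: "nat \<Rightarrow> 'a \<Rightarrow> real"
    and g F :: "real \<Rightarrow> real" +
  assumes T_pos: "T > 0"
    and rho: "\<rho> \<in> {0..1}"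
    and Mg_measurable: "random_variable (count_space UNIV) Mg"
    and X_measurable: "\<And>n. n \<ge> 1 \<Longrightarrow> random_variable borel (X n)"
    and pgf_Mg: "\<And>u. u \<in> {0..1} \<Longrightarrow> pgf Mg u = g u"
    and F_0: "F 0 = 0"
    and F_T: "F T = 1"
    and cdf_X: "\<And>n t. n \<ge> 1 \<Longrightarrow> t \<in> {0..T} \<Longrightarrow> cdf (distr M borel (X n)) t = F t"
    and correlation_X: "\<And>m n. m \<ge> 1 \<Longrightarrow> n \<ge> 1 \<Longrightarrow> m \<noteq> n \<Longrightarrow> correlation (X m) (X n) = \<rho>"
    and Mg_indep_X:
      "indep_set
         (sets (vimage_algebra (space M) Mg (count_space UNIV)))
         (sets (vimage_algebra (space M) (\<lambda>\<omega>. \<lambda>n\<in>{1..}. X n \<omega>) (Pi\<^sub>M {1..} (\<lambda>_. borel))))"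
    and pgf_counting_process:
      "\<And>t u. t \<in> {0..T} \<Longrightarrow> u \<in> {0..1} \<Longrightarrow>
         pgf (counting_process Mg X t) u =
           \<rho> * (1 - F t) + \<rho> * F t * g u + (1 - \<rho>) * g (1 - F t + F t * u)"

end

theory Submission
  imports Defs "HOL-Complex_Analysis.Cauchy_Integral_Formula"
begin

text \<open>Expanding every power $(1-u)^{\alpha r}$ in the Mittag-Leffler series by the binomial series
  and interchanging the two summations turns the prescribed generating function into a power series
  in $u$ on $[0,1)$; the probabilities are its coefficients. The interchange is justified by
  $|\binom{a}{k}| \le |\binom{-a}{k}|$ for $a \ge 0$, so that the double series of absolute values
  is dominated by the Mittag-Leffler series at $c (1-u)^{-\alpha}$, which converges because
  log-convexity gives $\Gamma(x+\nu) \ge (x-1)^\nu\, \Gamma(x)$.\<close>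

section \<open>Growth of Gamma and convergence of the Mittag-Leffler series\<close>

text \<open>The point \<open>x\<close> lies between \<open>x - 1\<close> and
  \<open>x + \<nu>\<close>. Convexity of ln Gamma bounds its value there, and
  \<open>Gamma x = (x - 1) * Gamma (x - 1)\<close> eliminates \<open>Gamma (x - 1)\<close>. The
  bound \<open>x > 1\<close> keeps all three points where Gamma is log-convex.\<close>

lemma Gamma_add_ge:
  fixes x \<nu> :: real
  assumes "x > 1" "\<nu> > 0"
  shows "Gamma (x + \<nu>) \<ge> (x - 1) powr \<nu> * Gamma x"
proof -
  \<comment> \<open>The weight for which the convex combination of \<open>x - 1\<close> and
    \<open>x + \<nu>\<close> is exactly \<open>x\<close>.\<close>
  let ?t = "1 / (1 + \<nu>)"
  have "(ln \<circ> Gamma) ((1 - ?t) *\<^sub>R (x - 1) + ?t *\<^sub>R (x + \<nu>)) \<le>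
      (1 - ?t) * (ln \<circ> Gamma) (x - 1) + ?t * (ln \<circ> Gamma) (x + \<nu>)"
    by (rule convex_onD[OF log_convex_Gamma_real]) (use assms in auto)
  moreover have "(1 - ?t) *\<^sub>R (x - 1) + ?t *\<^sub>R (x + \<nu>) = x"
    using assms by (simp add: divide_simps) (simp add: algebra_simps)
  moreover have "1 - ?t = \<nu> / (1 + \<nu>)"
    using assms by (simp add: field_simps)
  ultimately have "(1 + \<nu>) * ln (Gamma x) \<le>
      (1 + \<nu>) * (\<nu> / (1 + \<nu>) * ln (Gamma (x - 1)) + ?t * ln (Gamma (x + \<nu>)))"
    using assms by (intro mult_left_mono) auto
  also have "\<dots> = \<nu> * ln (Gamma (x - 1)) + ln (Gamma (x + \<nu>))"
    using assms by (simp add: distrib_left)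
  finally have conv: "(1 + \<nu>) * ln (Gamma x) \<le> \<nu> * ln (Gamma (x - 1)) + ln (Gamma (x + \<nu>))" .
  have "Gamma x = (x - 1) * Gamma (x - 1)"
    using Gamma_plus1[of "x - 1"] assms nonpos_Ints_nonpos[of "x - 1"] by force
  then have "ln (Gamma x) = ln (x - 1) + ln (Gamma (x - 1))"
    using assms by (simp add: ln_mult_pos)
  then have "\<nu> * ln (x - 1) + ln (Gamma x) \<le> ln (Gamma (x + \<nu>))"
    using conv by (simp add: algebra_simps)
  then have "exp (\<nu> * ln (x - 1) + ln (Gamma x)) \<le> exp (ln (Gamma (x + \<nu>)))"
    by simp
  then show ?thesis
    using assms by (simp add: exp_add powr_def)
qed

lemma summable_mittag_leffler:
  fixes x \<nu> :: real
  assumes "\<nu> > 0"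
  shows "summable (\<lambda>r. x ^ r * rGamma (\<nu> * real r + 1))"
proof -
  \<comment> \<open>For \<open>n \<ge> N\<close> this gives
    \<open>(\<nu> * real n) powr \<nu> \<ge> 2 * \<bar>x\<bar> + 1\<close>. By
    \<open>Gamma_add_ge\<close> at \<open>\<nu> * real n + 1\<close>, Gamma then grows at least by
    the factor \<open>2 * \<bar>x\<bar>\<close> per step, so the ratio of consecutive terms is at
    most 1/2.\<close>
  obtain N :: nat where N: "(2 * \<bar>x\<bar> + 1) powr (1 / \<nu>) / \<nu> < real N"
    using reals_Archimedean2 by blast
  show ?thesis
  proof (rule summable_ratio_test[of "1/2" N])
    fix n assume n: "n \<ge> N"
    let ?y = "\<nu> * real n + 1"
    have "(2 * \<bar>x\<bar> + 1) powr (1 / \<nu>) < \<nu> * real N"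
      using N assms by (simp add: field_simps)
    also have "\<dots> \<le> \<nu> * real n"
      using n assms by simp
    finally have le: "(2 * \<bar>x\<bar> + 1) powr (1 / \<nu>) < \<nu> * real n" .
    have pos: "\<nu> * real n > 0"
      using le powr_ge_zero[of "2 * \<bar>x\<bar> + 1" "1 / \<nu>"] by linarith
    have "((2 * \<bar>x\<bar> + 1) powr (1 / \<nu>)) powr \<nu> \<le> (\<nu> * real n) powr \<nu>"
      using le assms by (intro powr_mono2) auto
    then have "2 * \<bar>x\<bar> + 1 \<le> (\<nu> * real n) powr \<nu>"
      using assms by (simp add: powr_powr)
    then have "2 * \<bar>x\<bar> * Gamma ?y \<le> (?y - 1) powr \<nu> * Gamma ?y"
      using pos by (intro mult_right_mono) auto
    also have "\<dots> \<le> Gamma (?y + \<nu>)"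
      using Gamma_add_ge[of ?y \<nu>] pos assms by simp
    finally have G: "2 * \<bar>x\<bar> * Gamma ?y \<le> Gamma (?y + \<nu>)" .
    have Gp: "Gamma ?y > 0" "Gamma (?y + \<nu>) > 0"
      using pos assms by (auto intro!: Gamma_real_pos)
    have "\<bar>x\<bar> * inverse (Gamma (?y + \<nu>)) \<le> 1/2 * inverse (Gamma ?y)"
      using G Gp by (simp add: field_simps)
    then have "\<bar>x\<bar> ^ n * (\<bar>x\<bar> * inverse (Gamma (?y + \<nu>))) \<le> \<bar>x\<bar> ^ n * (1/2 * inverse (Gamma ?y))"
      by (intro mult_left_mono) auto
    moreover have "\<nu> * real (Suc n) + 1 = ?y + \<nu>"
      by (simp add: algebra_simps)
    ultimately show "norm (x ^ Suc n * rGamma (\<nu> * real (Suc n) + 1)) \<le>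
        1/2 * norm (x ^ n * rGamma ?y)"
      using Gp by (simp add: abs_mult power_abs rGamma_inverse_Gamma mult_ac add_ac)
  qed simp
qed

section \<open>Binomial expansion of the Mittag-Leffler function\<close>

text \<open>Compare the falling factorials factor by factor: \<open>\<bar>a - real i\<bar>\<close>
  is at most \<open>a + real i\<close>, which is the negative of the factor
  \<open>- a - real i\<close>.\<close>

lemma abs_gbinomial_le_gbinomial_minus:
  fixes a :: real
  assumes "a \<ge> 0"
  shows "\<bar>a gchoose k\<bar> \<le> (- 1) ^ k * ((- a) gchoose k)"
proof -
  have "\<bar>\<Prod>i=0..<k. a - real i\<bar> \<le> (\<Prod>i=0..<k. a + real i)"
    unfolding abs_prod using assms by (intro prod_mono) auto
  also have "\<dots> = (\<Prod>i=0..<k. - 1 * (- a - real i))"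
    by (intro prod.cong) auto
  also have "\<dots> = (- 1) ^ k * (\<Prod>i=0..<k. - a - real i)"
    by (subst prod.distrib) simp
  finally show ?thesis
    by (simp add: gbinomial_prod_rev divide_right_mono)
qed

text \<open>Fubini for double series: the sum over \<open>k\<close> is read as an integral over
  counting measure, which makes the interchange an instance of \<open>integral_suminf\<close>.
  Column summability follows from \<open>total\<close>, each entry being at most its absolute row
  sum.\<close>

lemma sums_swap:
  fixes f :: "nat \<Rightarrow> nat \<Rightarrow> real"
  assumes row: "\<And>r. summable (\<lambda>k. \<bar>f r k\<bar>)"
    and total: "summable (\<lambda>r. \<Sum>k. \<bar>f r k\<bar>)"
  shows "(\<lambda>k. \<Sum>r. f r k) sums (\<Sum>r. \<Sum>k. f r k)"
proof -
  have int: "integrable (count_space UNIV) (f r)" for r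
    using row by (simp add: integrable_count_space_nat_iff)
  have "\<bar>f r k\<bar> \<le> (\<Sum>k. \<bar>f r k\<bar>)" for r k
    using sum_le_suminf[OF row, of "{k}" r] by simp
  then have "summable (\<lambda>r. \<bar>f r k\<bar>)" for k
    by (intro summable_comparison_test[OF _ total]) auto
  then have col: "AE k in count_space UNIV. summable (\<lambda>r. norm (f r k))"
    by simp
  have "(\<integral>k. norm (f r k) \<partial>count_space UNIV) = (\<Sum>k. \<bar>f r k\<bar>)" for r
    using row by (subst integral_count_space_nat) (auto simp: integrable_count_space_nat_iff)
  then have tot: "summable (\<lambda>r. \<integral>k. norm (f r k) \<partial>count_space UNIV)"
    using total by simp
  have "(\<lambda>k. \<Sum>r. f r k) sums (\<integral>k. (\<Sum>r. f r k) \<partial>count_space UNIV)"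
    by (intro sums_integral_count_space_nat integrable_suminf[OF int col tot])
  also have "(\<integral>k. (\<Sum>r. f r k) \<partial>count_space UNIV) = (\<Sum>r. \<Sum>k. f r k)"
    by (simp add: integral_suminf[OF int col tot] integral_count_space_nat[OF int])
  finally show ?thesis .
qed

lemma mittag_leffler_binomial_expansion:
  fixes c \<alpha> \<nu> u :: real
  assumes "c \<ge> 0" "\<alpha> \<ge> 0" "\<nu> > 0" "u \<in> {0..<1}"
  shows "(\<lambda>k. (- 1) ^ k / fact k * (\<Sum>r. (- c) ^ r * rGamma (\<nu> * real r + 1) *
      (Gamma (\<alpha> * real r + 1) * rGamma (\<alpha> * real r + 1 - real k))) * u ^ k)
    sums mittag_leffler \<nu> 1 (- c * (1 - u) powr \<alpha>)"
proof -
  define w where "w r = (- c) ^ r * rGamma (\<nu> * real r + 1)" for r :: nat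
  define f where "f r k = w r * (((\<alpha> * real r) gchoose k) * (- u) ^ k)" for r k :: nat
  have pow: "(1 + - u) powr (b * real r) = ((1 - u) powr b) ^ r" for b r
    using assms by (simp add: powr_powr flip: powr_realpow)
  have inner: "(\<lambda>k. f r k) sums ((- c * (1 - u) powr \<alpha>) ^ r * rGamma (\<nu> * real r + 1))" for r
  proof -
    have "(\<lambda>k. f r k) sums (w r * (1 + - u) powr (\<alpha> * real r))"
      unfolding f_def using assms by (intro sums_mult gen_binomial_real) auto
    then show ?thesis
      unfolding w_def pow power_mult_distrib by (simp add: mult_ac)
  qed
  \<comment> \<open>The absolute binomial series is majorized by that of
    \<open>(1 - u) powr (- \<alpha> * real r)\<close>, whose terms are all nonnegative. Summing it
    over \<open>k\<close> gives a term of the Mittag-Leffler series at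
    \<open>c * (1 - u) powr (- \<alpha>)\<close>.\<close>
  define B where "B r k = \<bar>w r\<bar> * (((- \<alpha> * real r) gchoose k) * (- u) ^ k)" for r k :: nat
  have fB: "\<bar>f r k\<bar> \<le> B r k" for r k
  proof -
    have "\<bar>(\<alpha> * real r) gchoose k\<bar> * u ^ k \<le> (- 1) ^ k * ((- (\<alpha> * real r)) gchoose k) * u ^ k"
      using assms by (intro mult_right_mono abs_gbinomial_le_gbinomial_minus) auto
    moreover have "(- u) ^ k = (- 1) ^ k * u ^ k"
      by (simp flip: power_mult_distrib)
    ultimately have "\<bar>((\<alpha> * real r) gchoose k) * (- u) ^ k\<bar> \<le> ((- \<alpha> * real r) gchoose k) * (- u) ^ k"
      using assms by (simp add: abs_mult power_abs mult_ac)
    then show ?thesis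
      unfolding f_def B_def abs_mult[of "w r"] by (intro mult_left_mono) auto
  qed
  have Bsums: "B r sums ((c * (1 - u) powr (- \<alpha>)) ^ r * rGamma (\<nu> * real r + 1))" for r
  proof -
    have "B r sums (\<bar>w r\<bar> * (1 + - u) powr (- \<alpha> * real r))"
      unfolding B_def using assms by (intro sums_mult gen_binomial_real) auto
    moreover have "rGamma (\<nu> * real r + 1) \<ge> 0"
      using assms by (simp add: rGamma_inverse_Gamma add_nonneg_pos)
    ultimately show ?thesis
      using assms unfolding w_def pow power_mult_distrib
      by (simp add: abs_mult power_abs mult_ac)
  qed
  have row: "summable (\<lambda>k. \<bar>f r k\<bar>)" for r
    by (rule summable_comparison_test[OF _ sums_summable[OF Bsums[of r]]]) (use fB in auto)
  have "(\<Sum>k. \<bar>f r k\<bar>) \<le> (c * (1 - u) powr (- \<alpha>)) ^ r * rGamma (\<nu> * real r + 1)" for r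
    unfolding sums_unique[OF Bsums[of r]]
    by (rule suminf_le[OF fB row sums_summable[OF Bsums]])
  then have "summable (\<lambda>r. \<Sum>k. \<bar>f r k\<bar>)"
    using suminf_nonneg[OF row]
    by (intro summable_comparison_test[OF _ summable_mittag_leffler[OF \<open>\<nu> > 0\<close>]]) auto
  from sums_swap[OF row this]
  have "(\<lambda>k. \<Sum>r. f r k) sums mittag_leffler \<nu> 1 (- c * (1 - u) powr \<alpha>)"
    unfolding mittag_leffler_def by (simp add: sums_unique[OF inner, symmetric])
  moreover have "(\<Sum>r. f r k) = (- 1) ^ k / fact k * (\<Sum>r. w r *
      (Gamma (\<alpha> * real r + 1) * rGamma (\<alpha> * real r + 1 - real k))) * u ^ k" (is "?l = ?q * (\<Sum>r. ?h r) * _")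
    for k
  \<comment> \<open>Summability of \<open>?h\<close> is recovered from that of \<open>f r k\<close>
    by dividing by \<open>u ^ k\<close>. When this power is zero, both sides vanish and no
    summability is required; for \<open>u = 0\<close> and \<open>k = 0\<close> the power is
    1.\<close>
  proof (cases "u = 0 \<and> k > 0")
    case True
    then show ?thesis
      by (auto simp: f_def zero_power)
  next
    case False
    have fh: "f r k = (?q * u ^ k) * ?h r" for r
    proof -
      have "\<alpha> * real r + 1 > 0"
        using assms by (simp add: add_nonneg_pos)
      then have "\<alpha> * real r + 1 \<notin> \<int>\<^sub>\<le>\<^sub>0"
        using nonpos_Ints_nonpos[of "\<alpha> * real r + 1"] by linarith
      \<comment> \<open>Only \<open>\<alpha> * real r + 1\<close> has to avoid the poles. At a pole
        \<open>\<alpha> * real r + 1 - real k\<close> the binomial coefficient is 0, in agreement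
        with \<open>rGamma\<close>.\<close>
      then have "(\<alpha> * real r) gchoose k =
          Gamma (\<alpha> * real r + 1) * rGamma (\<alpha> * real r + 1 - real k) / fact k"
        by (simp add: gbinomial_Gamma rGamma_inverse_Gamma field_simps)
      moreover have "(- u) ^ k = (- 1) ^ k * u ^ k"
        by (simp flip: power_mult_distrib)
      ultimately show ?thesis
        by (simp add: f_def)
    qed
    have "?q * u ^ k \<noteq> 0"
      using False by auto
    moreover have "\<bar>f r k\<bar> \<le> (\<Sum>k. \<bar>f r k\<bar>)" for r
      using sum_le_suminf[OF row, of "{k}" r] by simp
    then have "summable (\<lambda>r. f r k)"
      by (intro summable_comparison_test[OF _ \<open>summable (\<lambda>r. \<Sum>k. \<bar>f r k\<bar>)\<close>]) auto
    ultimately have "summable ?h"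
      unfolding fh using False by (auto simp: summable_cmult_iff)
    then show ?thesis
      unfolding fh by (subst suminf_mult) (auto simp: mult_ac)
  qed
  ultimately show ?thesis
    unfolding w_def by simp
qed

section \<open>Probabilities as coefficients of the generating function\<close>

text \<open>The generating function is expanded only for nonnegative arguments, so equality is
  available only to the right of 0. Convergence there extends to the disc of radius
  \<open>R\<close>, and the zeros of a nonzero power series are isolated.\<close>

lemma powser_unique_right:
  fixes a b :: "nat \<Rightarrow> real"
  assumes "R > 0"
    and a: "\<And>x. x \<in> {0..<R} \<Longrightarrow> (\<lambda>k. a k * x ^ k) sums f x"
    and b: "\<And>x. x \<in> {0..<R} \<Longrightarrow> (\<lambda>k. b k * x ^ k) sums f x"
  shows "a = b"
proof (rule ccontr)
  assume "a \<noteq> b"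
  define d where "d k = a k - b k" for k
  define h where "h x = (\<Sum>k. d k * x ^ k)" for x
  have d0: "(\<lambda>k. d k * x ^ k) sums 0" if "x \<in> {0..<R}" for x
    using sums_diff[OF a b, OF that that] by (simp add: d_def algebra_simps)
  then have h0: "h x = 0" if "x \<in> {0..<R}" for x
    using that by (simp add: h_def sums_iff)
  have hs: "(\<lambda>k. d k * (x - 0) ^ k) sums h x" if x: "norm (x - 0) < R" for x
  proof -
    obtain y where y: "\<bar>x\<bar> < y" "y < R"
      using x dense by auto
    then have "summable (\<lambda>k. d k * y ^ k)"
      using d0[of y] by (simp add: sums_iff)
    then have "summable (\<lambda>k. d k * x ^ k)"
      by (rule powser_inside) (use y in auto)
    then show ?thesis
      by (simp add: h_def summable_sums)
  qed
  obtain m where m: "d m \<noteq> 0"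
    using \<open>a \<noteq> b\<close> by (auto simp: d_def)
  \<comment> \<open>\<open>powser_0_nonzero\<close> needs a nonzero coefficient of positive index,
    so the constant term is excluded first.\<close>
  have "d 0 = 0"
    using h0[of 0] \<open>R > 0\<close> by (simp add: h_def powser_zero)
  with m have "m > 0"
    by (cases m) auto
  from powser_0_nonzero[where a = d, OF \<open>R > 0\<close> hs h0 m this] \<open>R > 0\<close>
  obtain s where s: "s > 0" "\<And>z. z \<in> cball 0 s - {0} \<Longrightarrow> h z \<noteq> 0"
    by auto
  \<comment> \<open>This point is positive, within distance \<open>s\<close> of 0 and below
    \<open>R\<close>, so \<open>h\<close> would be both nonzero and zero there.\<close>
  have "h (min s (R / 2)) \<noteq> 0"
    using s(1) \<open>R > 0\<close> by (intro s(2)) auto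
  then show False
    using h0[of "min s (R / 2)"] s(1) \<open>R > 0\<close> by auto
qed

text \<open>\<open>u ^ Y\<close> is split over the events \<open>Y = k\<close>. The geometric
  series, convergent because \<open>u < 1\<close>, justifies integrating term by term.\<close>

lemma (in prob_space) pgf_sums:
  assumes Y: "random_variable (count_space UNIV) Y" and u: "u \<in> {0..<1}"
  shows "(\<lambda>k. \<P>(\<omega> in M. Y \<omega> = k) * u ^ k) sums pgf Y u"
proof -
  define A where "A k = {\<omega> \<in> space M. Y \<omega> = k}" for k
  have A: "A k \<in> events" for k
    unfolding A_def using Y by measurable
  define f where "f k \<omega> = indicator (A k) \<omega> * u ^ k" for k \<omega>
  have int: "integrable M (f k)" for k
    unfolding f_def using A by (simp add: emeasure_eq_measure less_top[symmetric])
  have If: "integral\<^sup>L M (f k) = prob (A k) * u ^ k" for k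
    unfolding f_def using A by simp
  have fsums: "(\<lambda>k. f k \<omega>) sums (u ^ Y \<omega>)" if "\<omega> \<in> space M" for \<omega>
  proof -
    have "(\<lambda>k. f k \<omega>) = (\<lambda>k. if k = Y \<omega> then u ^ k else 0)"
      using that by (auto simp: f_def A_def)
    then show ?thesis
      by (simp add: sums_single)
  qed
  have abs_f: "\<bar>f k \<omega>\<bar> = f k \<omega>" for k \<omega>
    using u by (simp add: f_def)
  have "summable (\<lambda>k. prob (A k) * u ^ k)"
  proof (rule summable_comparison_test[OF _ summable_geometric[of u]])
    show "\<exists>N. \<forall>k\<ge>N. norm (prob (A k) * u ^ k) \<le> u ^ k"
      using u by (auto simp: abs_mult intro!: mult_left_le_one_le)
  qed (use u in auto)
  then have "(\<lambda>k. integral\<^sup>L M (f k)) sums (\<integral>\<omega>. (\<Sum>k. f k \<omega>) \<partial>M)"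
    using fsums int by (intro sums_integral) (auto simp: abs_f If sums_iff)
  also have "(\<integral>\<omega>. (\<Sum>k. f k \<omega>) \<partial>M) = pgf Y u"
    unfolding pgf_def using fsums by (intro Bochner_Integration.integral_cong) (auto simp: sums_iff)
  finally show ?thesis
    by (simp add: If A_def)
qed

text \<open>For a fixed upper limit the sum is measurable by induction; the random limit
  \<open>Mg\<close> takes countably many values, so composing with it preserves
  measurability.\<close>

lemma (in correlated_counting_process) measurable_counting_process:
  "random_variable (count_space UNIV) (counting_process Mg X t)"
proof -
  have S: "(\<lambda>\<omega>. \<Sum>n = 1..m. indicator {0..t} (X n \<omega>) :: nat) \<in> measurable M (count_space UNIV)" for m
  proof (induction m)
    case (Suc m)
    have [measurable]: "X (Suc m) \<in> borel_measurable M"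
      by (rule X_measurable) simp
    have "(\<lambda>\<omega>. indicator {0..t} (X (Suc m) \<omega>) :: nat) \<in> measurable M (count_space UNIV)"
      unfolding indicator_def by measurable
    with Suc show ?case
      by simp
  qed simp
  have "counting_process Mg X t =
      (\<lambda>\<omega>. (\<lambda>m \<omega>. \<Sum>n = 1..m. indicator {0..t} (X n \<omega>)) (Mg \<omega>) \<omega>)"
    by (auto simp: counting_process_def)
  also have "\<dots> \<in> measurable M (count_space UNIV)"
    by (rule measurable_compose_countable[OF S Mg_measurable])
  finally show ?thesis .
qed

section \<open>Point probabilities of the correlated process\<close>

theorem proposition2p2:
  fixes M :: "'a measure"
    and Mg :: "'a \<Rightarrow> nat"
    and X :: "nat \<Rightarrow> 'a \<Rightarrow> real"
    and T lam \<alpha> \<nu> \<rho> t :: real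
    and k :: nat
  assumes "T > 0" and "lam > 0"
    and "\<alpha> \<in> {0<..1}" and "\<nu> \<in> {0<..1}" and "\<rho> \<in> {0..1}"
    and "correlated_counting_process M T \<rho> Mg X
           (\<lambda>u. mittag_leffler \<nu> 1 (- (lam powr \<alpha>) * T powr \<nu> * (1 - u) powr \<alpha>))
           (\<lambda>s. (s / T) powr (\<nu> / \<alpha>))"
    and "t \<in> {0..T}"
  shows "\<P>(\<omega> in M. counting_process Mg X t \<omega> = k) =
      (1 - \<rho>) * ((- 1) ^ k / fact k *
         (\<Sum>r. (- (lam powr \<alpha>) * t powr \<nu>) ^ r * rGamma (\<nu> * real r + 1) *
              (Gamma (\<alpha> * real r + 1) * rGamma (\<alpha> * real r + 1 - real k))))
      + \<rho> * ((1 - (t / T) powr (\<nu> / \<alpha>)) * (if k = 0 then 1 else 0)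
         + (t / T) powr (\<nu> / \<alpha>) * ((- 1) ^ k / fact k *
             (\<Sum>r. (- (lam powr \<alpha>) * T powr \<nu>) ^ r * rGamma (\<nu> * real r + 1) *
                  (Gamma (\<alpha> * real r + 1) * rGamma (\<alpha> * real r + 1 - real k)))))"
proof -
  interpret correlated_counting_process M T \<rho> Mg X
      "\<lambda>u. mittag_leffler \<nu> 1 (- (lam powr \<alpha>) * T powr \<nu> * (1 - u) powr \<alpha>)"
      "\<lambda>s. (s / T) powr (\<nu> / \<alpha>)"
    by fact
  define F where "F = (t / T) powr (\<nu> / \<alpha>)"
  define q where "q s k = (- 1) ^ k / fact k *
      (\<Sum>r. (- (lam powr \<alpha>) * s powr \<nu>) ^ r * rGamma (\<nu> * real r + 1) *
        (Gamma (\<alpha> * real r + 1) * rGamma (\<alpha> * real r + 1 - real k)))" for s :: real and k :: nat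
  define E where "E s u = mittag_leffler \<nu> 1 (- (lam powr \<alpha>) * s powr \<nu> * (1 - u) powr \<alpha>)"
    for s u :: real
  have q: "(\<lambda>k. q s k * u ^ k) sums E s u" if "u \<in> {0..<1}" for s u
    using mittag_leffler_binomial_expansion[of "lam powr \<alpha> * s powr \<nu>" \<alpha> \<nu> u] that assms
    by (simp add: q_def E_def)
  \<comment> \<open>The exponent \<open>\<nu> / \<alpha>\<close> makes
    \<open>F powr \<alpha>\<close> equal to \<open>(t / T) powr \<nu>\<close>. Thinning by
    \<open>F\<close> therefore only replaces \<open>T\<close> by \<open>t\<close> in the
    Mittag-Leffler argument, which is why the uncorrelated part has the coefficients
    \<open>q t\<close>.\<close>
  have E_thinned: "E T (1 - F + F * u) = E t u" if "u \<in> {0..<1}" for u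
  proof -
    have "T powr \<nu> * (1 - (1 - F + F * u)) powr \<alpha> = T powr \<nu> * (F * (1 - u)) powr \<alpha>"
      by (simp add: algebra_simps)
    also have "\<dots> = T powr \<nu> * (t / T) powr \<nu> * (1 - u) powr \<alpha>"
      using that assms by (simp add: F_def powr_mult powr_powr)
    also have "T powr \<nu> * (t / T) powr \<nu> = t powr \<nu>"
      using assms by (simp add: powr_divide)
    finally show ?thesis
      by (simp add: E_def mult.assoc)
  qed
  define p where "p k = (1 - \<rho>) * q t k
      + \<rho> * ((1 - F) * (if k = 0 then 1 else 0) + F * q T k)" for k
  have "(\<lambda>k. \<P>(\<omega> in M. counting_process Mg X t \<omega> = k)) = p"
  proof (rule powser_unique_right[of 1])
    fix u :: real assume u: "u \<in> {0..<1}"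
    show "(\<lambda>k. \<P>(\<omega> in M. counting_process Mg X t \<omega> = k) * u ^ k) sums
        pgf (counting_process Mg X t) u"
      by (rule pgf_sums[OF measurable_counting_process u])
    \<comment> \<open>The constant 1 as a power series, which yields the indicator of
      \<open>k = 0\<close> in the result; at \<open>u = 0\<close> it relies on
      \<open>0 ^ 0 = 1\<close>.\<close>
    have "(\<lambda>k. (if k = 0 then 1 else 0) * u ^ k) = (\<lambda>k. if k = 0 then u ^ k else 0)"
      by auto
    then have "(\<lambda>k. (if k = 0 then 1 else 0) * u ^ k) sums 1"
      using sums_single[of 0 "\<lambda>k. u ^ k"] by simp
    then have "(\<lambda>k. (1 - \<rho>) * (q t k * u ^ k) + \<rho> * ((1 - F) * ((if k = 0 then 1 else 0) * u ^ k)
        + F * (q T k * u ^ k))) sums ((1 - \<rho>) * E t u + \<rho> * ((1 - F) * 1 + F * E T u))"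
      by (intro sums_add sums_mult q u)
    moreover have "pgf (counting_process Mg X t) u =
        (1 - \<rho>) * E t u + \<rho> * ((1 - F) * 1 + F * E T u)"
      using pgf_counting_process[OF \<open>t \<in> {0..T}\<close>, of u] u E_thinned[OF u]
      unfolding F_def[symmetric] E_def[symmetric] by (simp add: algebra_simps)
    moreover have "p k * u ^ k = (1 - \<rho>) * (q t k * u ^ k) +
        \<rho> * ((1 - F) * ((if k = 0 then 1 else 0) * u ^ k) + F * (q T k * u ^ k))" for k
      by (simp add: p_def algebra_simps)
    ultimately show "(\<lambda>k. p k * u ^ k) sums pgf (counting_process Mg X t) u"
      by (simp only:)
  qed simp
  then show ?thesis
    by (simp add: fun_eq_iff p_def q_def F_def)
qed

end
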